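(* Let $d\in\mathbf{N}$. There exists a unique $\alpha_{\Delta^d}\in[1,\infty]$ such that: if $0<\alpha<\alpha_{\Delta^d}$ then $\mathcal{P}_\Delta^=(\mathbf{S}^d)$ is disjoint from $\operatorname{argmax}_{\mathcal{P}(\mathbf{S}^d)}E_\alpha$, whereas if $\alpha_{\Delta^d}<\alpha$ then $$\mathcal{P}_\Delta^=(\mathbf{S}^d)=\operatorname{argmax}_{\mathcal{P}(\mathbf{S}^d)}E_\alpha .$$ Moreover, the equality $\mathcal{P}_\Delta^=(\mathbf{S}^d)=\operatorname{argmax}_{\mathcal{P}(\mathbf{S}^d)}E_\alpha$ fails when $\alpha=1$, meaning that $\mathcal{P}_\Delta^=(\mathbf{S}^d)$ is either strictly contained in or disjoint from $\operatorname{argmax}_{\mathcal{P}(\mathbf{S}^d)}E_1$.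
   Context: $\mathbf{N}=\{1,2,\ldots\}$. $\mathbf{S}^d=\{x\in\mathbf{R}^{d+1}: |x|=1\}$ with geodesic distance $\rho(x,y)=\arccos(x\cdot y)$; $\mathcal{P}(\mathbf{S}^d)$ is the set of Borel probability measures on $\mathbf{S}^d$. Put $\Lambda(x,y)=\frac{2}{\pi}\min\{\rho(x,y),\pi-\rho(x,y)\}\in[0,1]$. For exponents $\alpha\in(0,\infty]$ set $E_\alpha(\mu)=\frac12\iint\Lambda^\alpha(x,y)\,d\mu(x)\,d\mu(y)$, where $\Lambda^\infty(x,y)=1$ if $x\cdot y=0$ and $\Lambda^\infty(x,y)=0$ otherwise. $\mathcal{P}_\Delta^=(\mathbf{S}^d)$ is the set of $\mu\in\mathcal{P}(\mathbf{S}^d)$ for which there is an orthonormal basis $\{v_0,\ldots,v_d\}$ of $\mathbf{R}^{d+1}$ with $\mu(\{v_i,-v_i\})=\frac{1}{d+1}$ for every $i=0,\ldots,d$. $\operatorname{argmax}_{\mathcal{P}(\mathbf{S}^d)}E_\alpha$ denotes the set of all maximizers of $E_\alpha$ over $\mathcal{P}(\mathbf{S}^d)$. *)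

theory Defs
  imports "HOL-Probability.Probability"
begin

text \<open>The sphere in dimension \<open>d\<close> is \<open>sphere 0 1\<close> in \<open>real ^ 'n\<close>, where \<open>CARD('n) = d + 1\<close>.\<close>

definition geodist :: "real ^ 'n \<Rightarrow> real ^ 'n \<Rightarrow> real" where
  "geodist x y = arccos (x \<bullet> y)"

definition Lam :: "real ^ 'n \<Rightarrow> real ^ 'n \<Rightarrow> real" where
  "Lam x y = 2 / pi * min (geodist x y) (pi - geodist x y)"

text \<open>Only exponents \<open>0 < \<alpha> \<le> \<infinity>\<close> are intended; for these, \<open>0 powr \<alpha> = 0\<close> is the usual value.\<close>

definition Lam_pow :: "ereal \<Rightarrow> real ^ 'n \<Rightarrow> real ^ 'n \<Rightarrow> real" where
  "Lam_pow \<alpha> x y =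
    (if \<alpha> = \<infinity> then (if x \<bullet> y = 0 then 1 else 0) else Lam x y powr real_of_ereal \<alpha>)"

definition sphere_probs :: "(real ^ 'n) measure set" where
  "sphere_probs = {\<mu>. prob_space \<mu> \<and> sets \<mu> = sets (restrict_space borel (sphere 0 1))}"

definition energy :: "ereal \<Rightarrow> (real ^ 'n) measure \<Rightarrow> real" where
  "energy \<alpha> \<mu> = 1 / 2 * (LINT y|\<mu>. LINT x|\<mu>. Lam_pow \<alpha> x y)"

definition energy_argmax :: "ereal \<Rightarrow> (real ^ 'n) measure set" where
  "energy_argmax \<alpha> = {\<mu>. is_arg_max (energy \<alpha>) (\<lambda>\<nu>. \<nu> \<in> sphere_probs) \<mu>}"

definition orthonormal_basis :: "(real ^ 'n) set \<Rightarrow> bool" where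
  "orthonormal_basis B \<longleftrightarrow> pairwise orthogonal B \<and> (\<forall>v\<in>B. norm v = 1) \<and> span B = UNIV"

definition simplex_probs_eq :: "(real ^ 'n) measure set" where
  "simplex_probs_eq =
    {\<mu> \<in> sphere_probs. \<exists>B. orthonormal_basis B \<and> (\<forall>v\<in>B. measure \<mu> {v, - v} = 1 / real CARD('n))}"

end

theory Submission
  imports Defs
begin

text \<open>Every simplex measure has energy \<open>d / (2 (d + 1))\<close>, whatever the exponent, while
  \<open>\<Lambda>\<^sup>\<alpha>\<close> decreases in \<open>\<alpha>\<close>. So once the simplex measures maximize at some exponent \<open>\<alpha>\<close>,
  they maximize at every \<open>\<beta> > \<alpha>\<close>, and a maximizer \<open>\<mu>\<close> at \<open>\<beta>\<close> has equal energies at \<open>\<alpha>\<close> and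
  \<open>\<beta>\<close>, which forces \<open>\<Lambda> \<in> {0, 1}\<close> almost everywhere. Such a \<open>\<mu>\<close> lives on an orthogonal frame,
  where the energy is \<open>(1 - \<Sum> m\<^sub>i\<^sup>2) / 2\<close> in terms of the masses of the axes, so the masses are equal.
  The threshold is therefore the infimum of the exponents at which simplex measures maximize; it is
  at least 1 because at \<open>\<alpha> = 1\<close> a measure outside the simplex class has the same energy.\<close>

section \<open>The kernel\<close>

lemma inner_sphere_bounds:
  fixes x y :: "real ^ 'n"
  assumes "norm x = 1" "norm y = 1"
  shows "-1 \<le> x \<bullet> y" "x \<bullet> y \<le> 1"
  using Cauchy_Schwarz_ineq2[of x y] assms by auto

lemma inner_unit_eq_1_iff:
  fixes x y :: "real ^ 'n"
  assumes "norm x = 1" "norm y = 1"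
  shows "x \<bullet> y = 1 \<longleftrightarrow> x = y"
  using norm_cauchy_schwarz_eq[of x y] assms by auto

lemma inner_unit_eq_minus_1_iff:
  fixes x y :: "real ^ 'n"
  assumes "norm x = 1" "norm y = 1"
  shows "x \<bullet> y = -1 \<longleftrightarrow> x = -y"
  using inner_unit_eq_1_iff[of x "-y"] assms by auto

lemma Lam_bounds:
  fixes x y :: "real ^ 'n"
  assumes "norm x = 1" "norm y = 1"
  shows "0 \<le> Lam x y" "Lam x y \<le> 1"
proof -
  have "0 \<le> arccos (x \<bullet> y)" "arccos (x \<bullet> y) \<le> pi"
    using arccos_bounded inner_sphere_bounds[OF assms] by auto
  then show "0 \<le> Lam x y" "Lam x y \<le> 1"
    by (auto simp: Lam_def geodist_def min_def field_simps)
qed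

lemma Lam_eq_0_iff:
  fixes x y :: "real ^ 'n"
  assumes "norm x = 1" "norm y = 1"
  shows "Lam x y = 0 \<longleftrightarrow> x \<bullet> y = 1 \<or> x \<bullet> y = -1"
proof -
  note b = inner_sphere_bounds[OF assms]
  have "0 \<le> arccos (x \<bullet> y)" "arccos (x \<bullet> y) \<le> pi"
    using arccos_bounded b by auto
  then have "Lam x y = 0 \<longleftrightarrow> arccos (x \<bullet> y) = 0 \<or> arccos (x \<bullet> y) = pi"
    by (auto simp: Lam_def geodist_def min_def)
  then show ?thesis
    using b arccos_eq_0_iff[of "x \<bullet> y"] arccos_eq_pi_iff[of "x \<bullet> y"] by auto
qed

lemma Lam_eq_1_iff:
  fixes x y :: "real ^ 'n"
  assumes "norm x = 1" "norm y = 1"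
  shows "Lam x y = 1 \<longleftrightarrow> x \<bullet> y = 0"
proof -
  note b = inner_sphere_bounds[OF assms]
  have "Lam x y = 1 \<longleftrightarrow> arccos (x \<bullet> y) = pi / 2"
    by (auto simp: Lam_def geodist_def min_def field_simps)
  also have "\<dots> \<longleftrightarrow> x \<bullet> y = 0"
    using b arccos_eq_iff[of "x \<bullet> y" 0] by auto
  finally show ?thesis .
qed

lemma Lam_pow_bounds:
  fixes x y :: "real ^ 'n"
  assumes "norm x = 1" "norm y = 1" "0 < \<alpha>"
  shows "0 \<le> Lam_pow \<alpha> x y" "Lam_pow \<alpha> x y \<le> 1"
proof -
  have "Lam x y powr r \<le> 1" if "0 < r" for r
    using Lam_bounds[OF assms(1,2)] that powr_mono2[of r "Lam x y" 1] by auto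
  then show "0 \<le> Lam_pow \<alpha> x y" "Lam_pow \<alpha> x y \<le> 1"
    using assms(3) by (cases \<alpha>; auto simp: Lam_pow_def)+
qed

lemma powr_strict_antimono_unit:
  fixes a b t :: real
  assumes "0 < a" "a < b" "0 \<le> t" "t \<le> 1"
  shows "t powr b \<le> t powr a" "t powr b = t powr a \<longleftrightarrow> t = 0 \<or> t = 1"
proof -
  have "t powr b < t powr a" if "t \<noteq> 0" "t \<noteq> 1"
    using that assms powr_less_mono'[of t a b] by auto
  then show "t powr b \<le> t powr a" "t powr b = t powr a \<longleftrightarrow> t = 0 \<or> t = 1"
    by (cases "t = 0 \<or> t = 1"; force)+
qed

text \<open>Powers of a number strictly between 0 and 1 strictly decrease in the exponent, and 0 and
  1 are fixed by every positive power. \<open>Lam\<close> takes the values 0 and 1 exactly at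
  (anti)parallel and at orthogonal pairs. This equality case is the source of all rigidity
  below.\<close>

lemma Lam_pow_antimono:
  fixes x y :: "real ^ 'n"
  assumes "norm x = 1" "norm y = 1" "0 < \<alpha>" "\<alpha> < \<beta>"
  shows "Lam_pow \<beta> x y \<le> Lam_pow \<alpha> x y"
    and "Lam_pow \<beta> x y = Lam_pow \<alpha> x y \<longleftrightarrow> x \<bullet> y \<in> {0, 1, -1}"
proof -
  note L = Lam_bounds[OF assms(1,2)] Lam_eq_0_iff[OF assms(1,2)] Lam_eq_1_iff[OF assms(1,2)]
  \<comment> \<open>Since \<alpha> < \<beta>, only \<beta> can be infinite.\<close>
  obtain a where a: "\<alpha> = ereal a" "0 < a"
    using assms(3,4) by (cases \<alpha>) auto
  have "Lam_pow \<beta> x y \<le> Lam_pow \<alpha> x y \<and>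
        (Lam_pow \<beta> x y = Lam_pow \<alpha> x y \<longleftrightarrow> x \<bullet> y \<in> {0, 1, -1})"
  proof (cases \<beta>)
    case (real b)
    then have "a < b" using a assms by auto
    then show ?thesis
      using powr_strict_antimono_unit[of a b "Lam x y"] a real L by (auto simp: Lam_pow_def)
  next
    case PInf
    have "Lam x y powr a \<noteq> 1" if "x \<bullet> y \<noteq> 0"
      using powr_less_mono2[of a "Lam x y" 1] a L that by auto
    then show ?thesis using a PInf L by (auto simp: Lam_pow_def)
  next
    case MInf
    then show ?thesis using assms by auto
  qed
  then show "Lam_pow \<beta> x y \<le> Lam_pow \<alpha> x y"
    and "Lam_pow \<beta> x y = Lam_pow \<alpha> x y \<longleftrightarrow> x \<bullet> y \<in> {0, 1, -1}" by auto
qed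

text \<open>On an orthogonal frame the exponent disappears from the kernel, which is why frame
  measures have the same energy at all positive exponents.\<close>

lemma Lam_pow_eq_of_bool:
  fixes x y :: "real ^ 'n"
  assumes "norm x = 1" "norm y = 1" "0 < \<alpha>" "x \<bullet> y \<in> {0, 1, -1}"
  shows "Lam_pow \<alpha> x y = of_bool (x \<bullet> y = 0)"
  using Lam_eq_0_iff[OF assms(1,2)] Lam_eq_1_iff[OF assms(1,2)] assms(3,4)
  by (cases \<alpha>) (auto simp: Lam_pow_def)

text \<open>The kernel is a Borel function of the inner product. The pair is ordered (y, x) because
  y is the outer variable of the energy integral.\<close>

lemma measurable_Lam_pow:
  fixes M N :: "(real ^ 'n) measure"
  assumes M: "sets M = sets (restrict_space borel (sphere 0 1))"
    and N: "sets N = sets (restrict_space borel (sphere 0 1))"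
  shows "(\<lambda>(y, x). Lam_pow \<alpha> x y) \<in> borel_measurable (M \<Otimes>\<^sub>M N)"
proof -
  have sp: "space M = sphere 0 1" "space N = sphere 0 1"
    using sets_eq_imp_space_eq[OF M] sets_eq_imp_space_eq[OF N] by (auto simp: space_restrict_space)
  have id[measurable]: "(\<lambda>x. x) \<in> M \<rightarrow>\<^sub>M borel" "(\<lambda>x. x) \<in> N \<rightarrow>\<^sub>M borel"
    unfolding measurable_cong_sets[OF M refl] measurable_cong_sets[OF N refl]
    by (auto intro!: measurable_restrict_space1)
  \<comment> \<open>Clamping to [-1, 1] makes \<open>arccos\<close> continuous on the whole line and
    changes nothing at inner products of unit vectors.\<close>
  define ac :: "real \<Rightarrow> real" where "ac = (\<lambda>t. arccos (max (-1) (min 1 t)))"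
  have "continuous_on UNIV ac"
    unfolding ac_def by (intro continuous_intros) auto
  then have [measurable]: "ac \<in> borel_measurable borel"
    by (rule borel_measurable_continuous_onI)
  have [measurable]: "(\<lambda>z. snd z \<bullet> fst z) \<in> borel_measurable (M \<Otimes>\<^sub>M N)"
    using measurable_compose[OF measurable_fst id(1)] measurable_compose[OF measurable_snd id(2)]
    by (intro borel_measurable_inner) auto
  define g where "g = (\<lambda>t. if \<alpha> = \<infinity> then (if t = 0 then 1 else 0)
    else (2 / pi * min (ac t) (pi - ac t)) powr real_of_ereal \<alpha>)"
  have [measurable]: "g \<in> borel_measurable borel"
    unfolding g_def by measurable
  have "(\<lambda>z. g (snd z \<bullet> fst z)) \<in> borel_measurable (M \<Otimes>\<^sub>M N)"
    by measurable
  moreover have "(case z of (y, x) \<Rightarrow> Lam_pow \<alpha> x y) = g (snd z \<bullet> fst z)"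
    if "z \<in> space (M \<Otimes>\<^sub>M N)" for z
  proof -
    have "norm (snd z) = 1" "norm (fst z) = 1"
      using that sp by (auto simp: space_pair_measure)
    from inner_sphere_bounds[OF this] show ?thesis
      by (auto simp: split_beta g_def ac_def Lam_pow_def Lam_def geodist_def)
  qed
  ultimately show ?thesis
    by (subst measurable_cong) auto
qed

section \<open>The energy\<close>

lemma sphere_probsD:
  assumes "\<mu> \<in> sphere_probs"
  shows "prob_space \<mu>" "sets \<mu> = sets (restrict_space borel (sphere 0 1))" "space \<mu> = sphere 0 1"
  using assms sets_eq_imp_space_eq[of \<mu> "restrict_space borel (sphere 0 1)"]
  by (auto simp: sphere_probs_def space_restrict_space)

lemma sphere_probs_AE_norm:
  assumes "\<mu> \<in> sphere_probs"
  shows "AE x in \<mu>. norm x = 1"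
  using sphere_probsD[OF assms] by (intro AE_I2) auto

lemma finite_in_sets:
  assumes "\<mu> \<in> sphere_probs" "finite A" "A \<subseteq> sphere 0 1"
  shows "A \<in> sets \<mu>"
  using assms(2,3) sphere_probsD(2)[OF assms(1)]
  by (auto simp: sets_restrict_space_iff intro: finite_imp_closed borel_closed)

text \<open>A bounded measurable function on a probability space: the inner energy integral is
  genuine, not the default 0 of a non-integrable function.\<close>

lemma integrable_Lam_pow:
  assumes "\<mu> \<in> sphere_probs" "norm y = 1" "0 < \<alpha>"
  shows "integrable \<mu> (\<lambda>x. Lam_pow \<alpha> x y)"
proof -
  interpret prob_space \<mu> using sphere_probsD[OF assms(1)] by simp
  note sp = sphere_probsD[OF assms(1)]
  have "(\<lambda>x. Lam_pow \<alpha> x y) \<in> borel_measurable \<mu>"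
    using measurable_compose[OF measurable_Pair1' measurable_Lam_pow[OF sp(2) sp(2)], of y \<alpha>] sp assms
    by simp
  then show ?thesis
    using sphere_probs_AE_norm[OF assms(1)] Lam_pow_bounds[OF _ assms(2,3)]
    by (intro integrable_const_bound[where B = 1]) (auto elim!: eventually_mono)
qed

lemma integral_Lam_pow_bounds:
  assumes "\<mu> \<in> sphere_probs" "norm y = 1" "0 < \<alpha>"
  shows "0 \<le> (LINT x|\<mu>. Lam_pow \<alpha> x y)" "(LINT x|\<mu>. Lam_pow \<alpha> x y) \<le> 1"
proof -
  interpret prob_space \<mu> using sphere_probsD[OF assms(1)] by simp
  note ae = sphere_probs_AE_norm[OF assms(1)]
  show "0 \<le> (LINT x|\<mu>. Lam_pow \<alpha> x y)"
    using ae Lam_pow_bounds[OF _ assms(2,3)] by (intro integral_nonneg_AE) (auto elim!: eventually_mono)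
  show "(LINT x|\<mu>. Lam_pow \<alpha> x y) \<le> 1"
    using ae Lam_pow_bounds[OF _ assms(2,3)]
    by (intro integral_le_const integrable_Lam_pow assms) (auto elim!: eventually_mono)
qed

lemma measurable_integral_Lam_pow:
  assumes "\<mu> \<in> sphere_probs"
  shows "(\<lambda>y. LINT x|\<mu>. Lam_pow \<alpha> x y) \<in> borel_measurable \<mu>"
proof -
  interpret prob_space \<mu> using sphere_probsD[OF assms(1)] by simp
  show ?thesis
    using measurable_Lam_pow[OF sphere_probsD(2)[OF assms] sphere_probsD(2)[OF assms], of \<alpha>]
    by (intro borel_measurable_lebesgue_integral) simp
qed

lemma integrable_integral_Lam_pow:
  assumes "\<mu> \<in> sphere_probs" "0 < \<alpha>"
  shows "integrable \<mu> (\<lambda>y. LINT x|\<mu>. Lam_pow \<alpha> x y)"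
proof -
  interpret prob_space \<mu> using sphere_probsD[OF assms(1)] by simp
  show ?thesis
    using sphere_probs_AE_norm[OF assms(1)] integral_Lam_pow_bounds[OF assms(1) _ assms(2)]
    by (intro integrable_const_bound[where B = 1] measurable_integral_Lam_pow assms)
      (auto elim!: eventually_mono)
qed

text \<open>Twice the difference of the energies is the iterated integral of the nonnegative
  difference \<open>f\<close> of the kernels. If it is zero, then \<open>f\<close> vanishes almost
  everywhere, and the equality case of \<open>Lam_pow_antimono\<close> applies.\<close>

lemma energy_antimono:
  fixes \<mu> :: "(real ^ 'n) measure"
  assumes "\<mu> \<in> sphere_probs" "0 < \<alpha>" "\<alpha> < \<beta>"
  shows "energy \<beta> \<mu> \<le> energy \<alpha> \<mu>"
    and "energy \<beta> \<mu> = energy \<alpha> \<mu> \<Longrightarrow> AE y in \<mu>. AE x in \<mu>. x \<bullet> y \<in> {0, 1, -1}"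
proof -
  have b: "0 < \<beta>" using assms by auto
  note ae = sphere_probs_AE_norm[OF assms(1)]
  define f where "f = (\<lambda>y x :: real ^ 'n. Lam_pow \<alpha> x y - Lam_pow \<beta> x y)"
  define F where "F = (\<lambda>y. LINT x|\<mu>. f y x)"
  have intf: "integrable \<mu> (f y)" if "norm y = 1" for y
    unfolding f_def using integrable_Lam_pow[OF assms(1) that] assms(2) b by auto
  have fnn: "AE x in \<mu>. 0 \<le> f y x" if "norm y = 1" for y
    using ae Lam_pow_antimono(1)[OF _ that assms(2,3)] by (auto simp: f_def elim!: eventually_mono)
  have F: "F y = (LINT x|\<mu>. Lam_pow \<alpha> x y) - (LINT x|\<mu>. Lam_pow \<beta> x y)" if "norm y = 1" for y
    unfolding F_def f_def
    using integrable_Lam_pow[OF assms(1) that] assms(2) b by (intro Bochner_Integration.integral_diff)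
  have Fnn: "AE y in \<mu>. 0 \<le> F y"
    using ae by eventually_elim (auto simp: F_def intro!: integral_nonneg_AE fnn)
  have "integrable \<mu> (\<lambda>y. (LINT x|\<mu>. Lam_pow \<alpha> x y) - (LINT x|\<mu>. Lam_pow \<beta> x y))"
    using assms b by (intro Bochner_Integration.integrable_diff integrable_integral_Lam_pow)
  \<comment> \<open>The formula for \<open>F\<close> is available only at unit vectors, so it is
    transferred by congruence on the space of \<mu>, which is the sphere.\<close>
  moreover have "integrable \<mu> F \<longleftrightarrow>
      integrable \<mu> (\<lambda>y. (LINT x|\<mu>. Lam_pow \<alpha> x y) - (LINT x|\<mu>. Lam_pow \<beta> x y))"
    by (intro Bochner_Integration.integrable_cong refl F)
      (use sphere_probsD(3)[OF assms(1)] in auto)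
  ultimately have intF: "integrable \<mu> F" by simp
  have "integral\<^sup>L \<mu> F = (LINT y|\<mu>. (LINT x|\<mu>. Lam_pow \<alpha> x y) - (LINT x|\<mu>. Lam_pow \<beta> x y))"
    by (intro Bochner_Integration.integral_cong refl F) (use sphere_probsD(3)[OF assms(1)] in auto)
  also have "\<dots> = 2 * energy \<alpha> \<mu> - 2 * energy \<beta> \<mu>"
    unfolding energy_def using integrable_integral_Lam_pow[OF assms(1)] assms(2) b
    by (subst Bochner_Integration.integral_diff) auto
  finally have eq: "integral\<^sup>L \<mu> F = 2 * energy \<alpha> \<mu> - 2 * energy \<beta> \<mu>" .
  show "energy \<beta> \<mu> \<le> energy \<alpha> \<mu>"
    using integral_nonneg_AE[OF Fnn] eq by simp
  assume "energy \<beta> \<mu> = energy \<alpha> \<mu>"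
  \<comment> \<open>A nonnegative function with integral 0 vanishes almost everywhere; this is used
    for the outer integral here and for the inner one below.\<close>
  then have "AE y in \<mu>. F y = 0"
    using integral_nonneg_eq_0_iff_AE[OF intF Fnn] eq by simp
  then show "AE y in \<mu>. AE x in \<mu>. x \<bullet> y \<in> {0, 1, -1}"
    using ae
  proof eventually_elim
    case (elim y)
    then have "AE x in \<mu>. f y x = 0"
      using integral_nonneg_eq_0_iff_AE[OF intf fnn] by (simp add: F_def)
    then show ?case
      using ae
    proof eventually_elim
      case (elim x)
      then show ?case
        using Lam_pow_antimono(2)[OF elim(2) \<open>norm y = 1\<close> assms(2,3)] by (simp add: f_def)
    qed
  qed
qed

section \<open>Measures supported on an orthogonal frame\<close>

lemma unit_pairwise_orthogonal_finite:
  fixes B :: "(real ^ 'n) set"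
  assumes "pairwise orthogonal B" "\<And>v. v \<in> B \<Longrightarrow> norm v = 1"
  shows "independent B" "finite B" "card B \<le> CARD('n)"
proof -
  have "0 \<notin> B" using assms(2) by force
  then show "independent B" using assms(1) by (intro pairwise_orthogonal_independent)
  then show "finite B" "card B \<le> CARD('n)" using independent_bound[of B] by auto
qed

lemma unit_pairwise_orthogonal_disjoint:
  fixes B :: "(real ^ 'n) set"
  assumes "pairwise orthogonal B" "\<And>v. v \<in> B \<Longrightarrow> norm v = 1"
  shows "disjoint_family_on (\<lambda>v. {v, -v}) B"
  unfolding disjoint_family_on_def
proof (intro ballI impI)
  fix v w assume "v \<in> B" "w \<in> B" "v \<noteq> w"
  then have "v \<bullet> w = 0" "v \<bullet> v = 1"
    using assms by (auto simp: pairwise_def orthogonal_def dot_square_norm)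
  then have "w \<noteq> v" "w \<noteq> - v" by auto
  then show "{v, -v} \<inter> {w, -w} = {}" by auto
qed

lemma sum_measure_axes:
  assumes "\<mu> \<in> sphere_probs" "pairwise orthogonal B" "\<And>v. v \<in> B \<Longrightarrow> norm v = 1"
  shows "(\<Sum>v\<in>B. measure \<mu> {v, -v}) = measure \<mu> (\<Union>v\<in>B. {v, -v})"
proof -
  interpret prob_space \<mu> using sphere_probsD[OF assms(1)] by simp
  have "{v, -v} \<in> sets \<mu>" if "v \<in> B" for v
    using assms that by (intro finite_in_sets) auto
  then show ?thesis
    using unit_pairwise_orthogonal_disjoint[OF assms(2,3)] unit_pairwise_orthogonal_finite[OF assms(2,3)]
    by (intro finite_measure_finite_Union[symmetric]) auto
qed

text \<open>The kernel is 0 within an axis and 1 between distinct axes, so twice the energy is the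
  probability that two independent points lie on different axes.\<close>

lemma energy_frame_support:
  assumes mu: "\<mu> \<in> sphere_probs" and B: "pairwise orthogonal B" "\<And>v. v \<in> B \<Longrightarrow> norm v = 1"
    and ae: "AE x in \<mu>. x \<in> (\<Union>v\<in>B. {v, -v})" and "0 < \<alpha>"
  shows "energy \<alpha> \<mu> = 1 / 2 * (1 - (\<Sum>v\<in>B. (measure \<mu> {v, -v})\<^sup>2))"
    and "(\<Sum>v\<in>B. measure \<mu> {v, -v}) = 1"
proof -
  interpret prob_space \<mu> using sphere_probsD[OF mu] by simp
  note fin = unit_pairwise_orthogonal_finite(2)[OF B]
  have sets[measurable]: "{v, -v} \<in> sets \<mu>" if "v \<in> B" for v
    using B that by (intro finite_in_sets mu) auto
  have "(\<Union>v\<in>B. {v, -v}) \<in> sets \<mu>" using sets fin by auto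
  from prob_eq_1[OF this] show sum1: "(\<Sum>v\<in>B. measure \<mu> {v, -v}) = 1"
    using ae sum_measure_axes[OF mu B] by simp
  have int: "integrable \<mu> (indicator {v, -v} :: _ \<Rightarrow> real)" if "v \<in> B" for v
    using sets[OF that] by (intro integrable_real_indicator) (auto simp: less_top[symmetric])
  \<comment> \<open>The potential at a point of the axis of \<open>v\<close> is the mass of all
    other axes.\<close>
  have inner: "(LINT x|\<mu>. Lam_pow \<alpha> x y) = 1 - measure \<mu> {v, -v}" if v: "v \<in> B" "y \<in> {v, -v}" for v y
  proof -
    have "(LINT x|\<mu>. Lam_pow \<alpha> x y) = (LINT x|\<mu>. 1 - indicator {v, -v} x)"
    proof (rule integral_cong_AE)
      have "norm y = 1" using v B by auto
      then show "(\<lambda>x. Lam_pow \<alpha> x y) \<in> borel_measurable \<mu>"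
        using integrable_Lam_pow[OF mu _ \<open>0 < \<alpha>\<close>] by auto
      show "(\<lambda>x. 1 - indicator {v, -v} x :: real) \<in> borel_measurable \<mu>"
        using sets[OF v(1)] by measurable
      show "AE x in \<mu>. Lam_pow \<alpha> x y = 1 - indicator {v, -v} x"
        using ae
      proof eventually_elim
        case (elim x)
        then obtain w where w: "w \<in> B" "x \<in> {w, -w}" by auto
        have nx: "norm x = 1" using w B by auto
        have vv: "v \<bullet> v = 1" using v B by (simp add: dot_square_norm)
        show ?case
        proof (cases "w = v")
          case True
          then have "x \<bullet> y \<in> {1, -1}" using w v vv by auto
          then show ?thesis
            using Lam_pow_eq_of_bool[OF nx \<open>norm y = 1\<close> \<open>0 < \<alpha>\<close>] w True by auto
        next
          case False
          then have wv: "w \<bullet> v = 0" using B(1) w v by (auto simp: pairwise_def orthogonal_def)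
          then have "x \<bullet> y = 0" using w v by auto
          moreover have "x \<notin> {v, -v}" using w wv vv by auto
          ultimately show ?thesis
            using Lam_pow_eq_of_bool[OF nx \<open>norm y = 1\<close> \<open>0 < \<alpha>\<close>] by auto
        qed
      qed
    qed
    also have "\<dots> = 1 - measure \<mu> {v, -v}"
      using int[OF v(1)] sets.sets_into_space[OF sets[OF v(1)]]
      by (subst Bochner_Integration.integral_diff) (auto simp: prob_space Int_absorb2)
    finally show ?thesis .
  qed
  \<comment> \<open>The potential as a step function, constant on each axis, so that the outer
    integral becomes a finite sum.\<close>
  define g where "g = (\<lambda>y. \<Sum>v\<in>B. (1 - measure \<mu> {v, -v}) * indicator {v, -v} y)"
  have "(LINT y|\<mu>. LINT x|\<mu>. Lam_pow \<alpha> x y) = (LINT y|\<mu>. g y)"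
  proof (rule integral_cong_AE)
    show "(\<lambda>y. LINT x|\<mu>. Lam_pow \<alpha> x y) \<in> borel_measurable \<mu>"
      by (rule measurable_integral_Lam_pow[OF mu])
    show "g \<in> borel_measurable \<mu>"
      unfolding g_def using sets by (intro borel_measurable_sum borel_measurable_times) auto
    show "AE y in \<mu>. (LINT x|\<mu>. Lam_pow \<alpha> x y) = g y"
      using ae
    proof eventually_elim
      case (elim y)
      then obtain v where v: "v \<in> B" "y \<in> {v, -v}" by auto
      have "g y = (\<Sum>w\<in>B. if w = v then 1 - measure \<mu> {v, -v} else 0)"
        unfolding g_def
      proof (rule sum.cong)
        fix w assume "w \<in> B"
        then show "(1 - measure \<mu> {w, -w}) * indicator {w, -w} y =
            (if w = v then 1 - measure \<mu> {v, -v} else 0)"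
          using v unit_pairwise_orthogonal_disjoint[OF B] by (auto simp: disjoint_family_on_def indicator_def)
      qed simp
      then show ?case using inner[OF v] v fin by simp
    qed
  qed
  also have "\<dots> = (\<Sum>v\<in>B. (1 - measure \<mu> {v, -v}) * measure \<mu> {v, -v})"
    unfolding g_def using int sets.sets_into_space[OF sets]
    by (subst Bochner_Integration.integral_sum) (auto simp: Int_absorb2 intro!: sum.cong)
  also have "\<dots> = 1 - (\<Sum>v\<in>B. (measure \<mu> {v, -v})\<^sup>2)"
    using sum1 by (simp add: algebra_simps sum_subtractf power2_eq_square)
  finally show "energy \<alpha> \<mu> = 1 / 2 * (1 - (\<Sum>v\<in>B. (measure \<mu> {v, -v})\<^sup>2))"
    by (simp add: energy_def)
qed

section \<open>Simplex measures and how to recognize them\<close>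

lemma orthonormal_basisD:
  fixes B :: "(real ^ 'n) set"
  assumes "orthonormal_basis B"
  shows "pairwise orthogonal B" "\<And>v. v \<in> B \<Longrightarrow> norm v = 1" "finite B" "card B = CARD('n)"
proof -
  show B: "pairwise orthogonal B" "\<And>v. v \<in> B \<Longrightarrow> norm v = 1"
    using assms by (auto simp: orthonormal_basis_def)
  note u = unit_pairwise_orthogonal_finite[OF B]
  show "finite B" by (rule u)
  have "card B = dim (span B)" using u(1) by (simp add: dim_eq_card_independent)
  also have "span B = UNIV" using assms by (simp add: orthonormal_basis_def)
  finally show "card B = CARD('n)" by simp
qed

text \<open>The disjoint axes, as many as the dimension, have total mass 1, so nothing is left off
  the frame.\<close>

lemma simplex_probs_eqD:
  fixes \<mu> :: "(real ^ 'n) measure"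
  assumes "\<mu> \<in> simplex_probs_eq"
  obtains B where "orthonormal_basis B" "\<And>v. v \<in> B \<Longrightarrow> measure \<mu> {v, -v} = 1 / CARD('n)"
    "AE x in \<mu>. x \<in> (\<Union>v\<in>B. {v, -v})"
proof -
  have mu: "\<mu> \<in> sphere_probs" using assms by (auto simp: simplex_probs_eq_def)
  then interpret prob_space \<mu> using sphere_probsD by blast
  obtain B where B: "orthonormal_basis B" "\<And>v. v \<in> B \<Longrightarrow> measure \<mu> {v, -v} = 1 / CARD('n)"
    using assms by (auto simp: simplex_probs_eq_def)
  note o = orthonormal_basisD[OF B(1)]
  have "measure \<mu> (\<Union>v\<in>B. {v, -v}) = 1"
    using sum_measure_axes[OF mu o(1,2)] B(2) o(4) by simp
  then have "AE x in \<mu>. x \<in> (\<Union>v\<in>B. {v, -v})"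
    by (rule AE_prob_1)
  then show ?thesis using that B by blast
qed

lemma simplex_probs_eq_subset: "simplex_probs_eq \<subseteq> sphere_probs"
  by (auto simp: simplex_probs_eq_def)

lemma energy_simplex_probs_eq:
  fixes \<mu> :: "(real ^ 'n) measure"
  assumes "\<mu> \<in> simplex_probs_eq" "0 < \<alpha>"
  shows "energy \<alpha> \<mu> = 1 / 2 * (1 - 1 / CARD('n))"
proof -
  obtain B where B: "orthonormal_basis B" "\<And>v. v \<in> B \<Longrightarrow> measure \<mu> {v, -v} = 1 / CARD('n)"
    "AE x in \<mu>. x \<in> (\<Union>v\<in>B. {v, -v})"
    using simplex_probs_eqD[OF assms(1)] by blast
  note o = orthonormal_basisD[OF B(1)]
  show ?thesis
    using energy_frame_support(1)[OF _ o(1,2) B(3) assms(2)] simplex_probs_eq_subset assms(1) o(4) B(2)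
    by (auto simp: power2_eq_square)
qed

text \<open>Take a largest orthogonal set \<open>B\<close> of typical points. A further typical
  point lies on an axis of \<open>B\<close> or is orthogonal to all of \<open>B\<close>; in the
  second case it would enlarge \<open>B\<close>.\<close>

lemma frame_support_of_inner:
  fixes \<mu> :: "(real ^ 'n) measure"
  assumes mu: "\<mu> \<in> sphere_probs" and ae: "AE y in \<mu>. AE x in \<mu>. x \<bullet> y \<in> {0, 1, -1}"
  obtains B where "pairwise orthogonal B" "\<And>v. v \<in> B \<Longrightarrow> norm v = 1"
    "AE x in \<mu>. x \<in> (\<Union>v\<in>B. {v, -v})"
proof -
  \<comment> \<open>The typical points: choosing \<open>B\<close> inside \<open>G\<close> controls
    the inner products of almost every \<open>x\<close> with each member of
    \<open>B\<close>.\<close>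
  define G where "G = {y. norm y = 1 \<and> (AE x in \<mu>. x \<bullet> y \<in> {0, 1, -1})}"
  have aeG: "AE y in \<mu>. y \<in> G"
    using ae sphere_probs_AE_norm[OF mu] by eventually_elim (auto simp: G_def)
  define P where "P = (\<lambda>B. B \<subseteq> G \<and> pairwise orthogonal B)"
  \<comment> \<open>Orthogonal unit vectors number at most the dimension; the added 1 makes the
    bound strict. With the empty set as a start, a largest set exists.\<close>
  have "card B < CARD('n) + 1" if "P B" for B
    using that unit_pairwise_orthogonal_finite(3)[of B] by (force simp: P_def G_def)
  then obtain B where B: "P B" "\<And>C. P C \<Longrightarrow> card C \<le> card B"
    using ex_has_greatest_nat[of P "{}" card "CARD('n) + 1"] by (force simp: P_def)
  have o: "pairwise orthogonal B" "\<And>v. v \<in> B \<Longrightarrow> norm v = 1"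
    using B(1) by (auto simp: P_def G_def)
  note fin = unit_pairwise_orthogonal_finite(2)[OF o]
  have "AE x in \<mu>. \<forall>v\<in>B. x \<bullet> v \<in> {0, 1, -1}"
    using B(1) fin by (intro AE_finite_allI) (auto simp: P_def G_def)
  then have "AE x in \<mu>. x \<in> (\<Union>v\<in>B. {v, -v})"
    using aeG
  proof eventually_elim
    case (elim x)
    have nx: "norm x = 1" using elim(2) by (simp add: G_def)
    show ?case
    proof (rule ccontr)
      assume c: "x \<notin> (\<Union>v\<in>B. {v, -v})"
      have 0: "x \<bullet> v = 0" if "v \<in> B" for v
        using elim(1) that c inner_unit_eq_1_iff[OF nx o(2)[OF that]]
          inner_unit_eq_minus_1_iff[OF nx o(2)[OF that]] by auto
      then have "P (insert x B)"
        using B(1) elim(2) by (auto simp: P_def pairwise_insert orthogonal_def inner_commute)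
      moreover have "x \<notin> B" using c by auto
      ultimately show False using B(2)[of "insert x B"] fin by simp
    qed
  qed
  then show ?thesis using that o by blast
qed

text \<open>A variance argument: with \<open>N\<close> the dimension, the energy bound makes the sum
  of squared masses at most \<open>1 / N\<close>. Since the masses sum to 1 on at most
  \<open>N\<close> axes, there must be exactly \<open>N\<close> axes of equal mass.\<close>

lemma simplex_probs_eqI:
  fixes \<mu> :: "(real ^ 'n) measure"
  assumes mu: "\<mu> \<in> sphere_probs" and B: "pairwise orthogonal B" "\<And>v. v \<in> B \<Longrightarrow> norm v = 1"
    and ae: "AE x in \<mu>. x \<in> (\<Union>v\<in>B. {v, -v})"
    and "0 < \<alpha>" and ge: "energy \<alpha> \<mu> \<ge> 1 / 2 * (1 - 1 / CARD('n))"
  shows "\<mu> \<in> simplex_probs_eq"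
proof -
  define N where "N = real CARD('n)"
  have N: "N > 0" by (simp add: N_def)
  define m where "m v = measure \<mu> {v, -v}" for v
  note u = unit_pairwise_orthogonal_finite[OF B]
  note e = energy_frame_support[OF mu B ae \<open>0 < \<alpha>\<close>, folded m_def]
  have sq: "(\<Sum>v\<in>B. (m v)\<^sup>2) \<le> 1 / N" using ge e(1) by (simp add: N_def)
  have k: "real (card B) \<le> N" using u by (simp add: N_def)
  \<comment> \<open>The squared deviation from \<open>1 / N\<close> is nonnegative, yet bounded by a
    multiple of \<open>card B - N\<close>, which is at most 0; this settles the number of axes and
    their masses together.\<close>
  have "(\<Sum>v\<in>B. (m v - 1 / N)\<^sup>2) = (\<Sum>v\<in>B. (m v)\<^sup>2) - 2 / N * (\<Sum>v\<in>B. m v) + card B / N\<^sup>2"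
    by (simp add: power2_diff sum.distrib sum_subtractf power_divide flip: sum_distrib_left sum_divide_distrib)
  also have "\<dots> \<le> (card B - N) / N\<^sup>2"
    using sq e(2) N by (simp add: field_simps power2_eq_square)
  finally have le: "(\<Sum>v\<in>B. (m v - 1 / N)\<^sup>2) \<le> (card B - N) / N\<^sup>2" .
  have nn: "0 \<le> (\<Sum>v\<in>B. (m v - 1 / N)\<^sup>2)" by (intro sum_nonneg) auto
  have "0 \<le> (card B - N) / N\<^sup>2" using le nn by linarith
  then have card: "real (card B) = N" using k N by (simp add: zero_le_divide_iff)
  then have "(\<Sum>v\<in>B. (m v - 1 / N)\<^sup>2) = 0" using le nn by simp
  then have "\<forall>v\<in>B. m v = 1 / N"
    using u(2) by (subst (asm) sum_nonneg_eq_0_iff) auto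
  moreover have "orthonormal_basis B"
  proof -
    have "UNIV \<subseteq> span B"
      using u card by (intro card_ge_dim_independent) (auto simp: N_def)
    then show ?thesis using B by (auto simp: orthonormal_basis_def)
  qed
  ultimately show ?thesis
    using mu by (auto simp: simplex_probs_eq_def m_def N_def)
qed

section \<open>Maximizers\<close>

lemma energy_argmax_iff:
  fixes \<mu> :: "(real ^ 'n) measure"
  shows
  "\<mu> \<in> energy_argmax \<alpha> \<longleftrightarrow> \<mu> \<in> sphere_probs \<and> 
    (\<forall>\<nu>\<in>sphere_probs. energy \<alpha> (\<nu> :: (real ^ 'n) measure) \<le> energy \<alpha> \<mu>)"
  by (auto simp: energy_argmax_def is_arg_max_def not_less)

text \<open>All simplex measures share one energy, so they maximize together.\<close>

lemma simplex_probs_eq_all_or_none: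
  fixes \<mu> :: "(real ^ 'n) measure"
  assumes "0 < \<alpha>" "\<mu> \<in> simplex_probs_eq" "\<mu> \<in> energy_argmax \<alpha>"
  shows "simplex_probs_eq \<subseteq> (energy_argmax \<alpha> :: (real ^ 'n) measure set)"
proof
  fix \<nu> :: "(real ^ 'n) measure" assume "\<nu> \<in> simplex_probs_eq"
  then show "\<nu> \<in> energy_argmax \<alpha>"
    using assms simplex_probs_eq_subset energy_simplex_probs_eq[of \<mu> \<alpha>] energy_simplex_probs_eq[of \<nu> \<alpha>]
    unfolding energy_argmax_iff by auto
qed

lemma simplex_probs_eq_argmax_above:
  fixes \<mu> :: "(real ^ 'n) measure"
  assumes "0 < \<alpha>" "\<alpha> < \<beta>" "\<mu> \<in> simplex_probs_eq" "\<mu> \<in> energy_argmax \<alpha>"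
  shows "simplex_probs_eq = (energy_argmax \<beta> :: (real ^ 'n) measure set)"
proof
  have b: "0 < \<beta>" using assms by auto
  note E = energy_simplex_probs_eq[OF assms(3) assms(1)] energy_simplex_probs_eq[OF assms(3) b]
  have mu: "\<mu> \<in> sphere_probs" using assms simplex_probs_eq_subset by blast
  have le: "energy \<alpha> \<nu> \<le> 1 / 2 * (1 - 1 / CARD('n))" if "\<nu> \<in> sphere_probs" for \<nu> :: "(real ^ 'n) measure"
    using assms(4) that E by (auto simp: energy_argmax_iff)
  have "\<mu> \<in> energy_argmax \<beta>"
    \<comment> \<open>From \<alpha> to \<beta> the energy of \<mu> stays fixed, while that of any
      competitor can only drop.\<close>
    unfolding energy_argmax_iff E(2)
    using mu le energy_antimono(1)[OF _ assms(1,2)] order_trans by blast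
  then show "simplex_probs_eq \<subseteq> (energy_argmax \<beta> :: (real ^ 'n) measure set)"
    using simplex_probs_eq_all_or_none b assms(3) by blast
  show "(energy_argmax \<beta> :: (real ^ 'n) measure set) \<subseteq> simplex_probs_eq"
  proof
    fix \<nu> :: "(real ^ 'n) measure" assume "\<nu> \<in> energy_argmax \<beta>"
    then have nu: "\<nu> \<in> sphere_probs" "energy \<beta> \<nu> \<ge> 1 / 2 * (1 - 1 / CARD('n))"
      using mu E by (force simp: energy_argmax_iff)+
    \<comment> \<open>Squeeze: the simplex value is at most the energy at \<beta>, which is at most
      the energy at \<alpha>, which is at most the simplex value.\<close>
    have "energy \<beta> \<nu> = energy \<alpha> \<nu>"
      using energy_antimono(1)[OF nu(1) assms(1,2)] le[OF nu(1)] nu(2) by linarith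
    then obtain B where "pairwise orthogonal B" "\<And>v. v \<in> B \<Longrightarrow> norm v = 1"
      "AE x in \<nu>. x \<in> (\<Union>v\<in>B. {v, -v})"
      using frame_support_of_inner[OF nu(1) energy_antimono(2)[OF nu(1) assms(1,2)]] by blast
    then show "\<nu> \<in> simplex_probs_eq" using simplex_probs_eqI[OF nu(1)] b nu(2) by blast
  qed
qed

section \<open>Uniform measures on finite families of points\<close>

text \<open>A pushforward from an index type, so that repeated points count with multiplicity; two
  frames sharing axes need this.\<close>

definition unif_points :: "('k::finite \<Rightarrow> real ^ 'n) \<Rightarrow> (real ^ 'n) measure" where
  "unif_points f = distr (measure_pmf (pmf_of_set UNIV)) (restrict_space borel (sphere 0 1)) f"

lemma measurable_to_sphere:
  fixes f :: "'k \<Rightarrow> real ^ 'n"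
  assumes "\<And>k. norm (f k) = 1"
  shows "f \<in> measure_pmf p \<rightarrow>\<^sub>M restrict_space borel (sphere 0 1)"
  using assms by (intro measurable_restrict_space2) auto

lemma unif_points_in_sphere_probs:
  fixes f :: "'k::finite \<Rightarrow> real ^ 'n"
  assumes "\<And>k. norm (f k) = 1"
  shows "unif_points f \<in> sphere_probs"
  unfolding sphere_probs_def unif_points_def
  using measurable_to_sphere[of f, OF assms] by (auto intro!: measure_pmf.prob_space_distr)

lemma integral_unif_points:
  fixes f :: "'k::finite \<Rightarrow> real ^ 'n"
  assumes "\<And>k. norm (f k) = 1" "g \<in> borel_measurable (unif_points f)"
  shows "(LINT x|unif_points f. g x) = (\<Sum>k\<in>UNIV. g (f k)) / CARD('k)"
  using assms(2) unfolding unif_points_def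
  by (subst integral_distr[OF measurable_to_sphere[of f, OF assms(1)]]) (auto simp: integral_pmf_of_set)

lemma energy_unif_points:
  fixes f :: "'k::finite \<Rightarrow> real ^ 'n"
  assumes "\<And>k. norm (f k) = 1" "0 < \<alpha>"
  shows "energy \<alpha> (unif_points f) =
    1 / 2 * ((\<Sum>k\<in>UNIV. (\<Sum>l\<in>UNIV. Lam_pow \<alpha> (f l) (f k)) / CARD('k)) / CARD('k))"
proof -
  note s = unif_points_in_sphere_probs[of f, OF assms(1)]
  have "(LINT x|unif_points f. Lam_pow \<alpha> x (f k)) = (\<Sum>l\<in>UNIV. Lam_pow \<alpha> (f l) (f k)) / CARD('k)" for k
    using integrable_Lam_pow[OF s assms(1) assms(2)]
    by (intro integral_unif_points assms(1)) auto
  then show ?thesis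
    unfolding energy_def
    using integral_unif_points[of f, OF assms(1) measurable_integral_Lam_pow[OF s]] by simp
qed

text \<open>Every index has positive weight, so no point of the family is negligible.\<close>

lemma unif_points_AE_iff:
  fixes f :: "'k::finite \<Rightarrow> real ^ 'n"
  assumes "\<And>k. norm (f k) = 1" "finite A" "A \<subseteq> sphere 0 1"
  shows "(AE x in unif_points f. x \<in> A) \<longleftrightarrow> range f \<subseteq> A"
proof -
  have "A \<in> sets (restrict_space borel (sphere 0 1))"
    using finite_in_sets[OF unif_points_in_sphere_probs[of f, OF assms(1)] assms(2,3)]
    by (simp add: unif_points_def)
  moreover have "{x \<in> space (restrict_space borel (sphere 0 1)). x \<in> A} = A"
    using assms(3) by (auto simp: space_restrict_space)
  ultimately show ?thesis
    unfolding unif_points_def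
    by (subst AE_distr_iff[OF measurable_to_sphere[of f, OF assms(1)]]) (auto simp: AE_measure_pmf_iff)
qed

text \<open>The witness is uniform on the coordinate vectors. Its energy at exponent 1 equals the
  simplex value, so \<open>simplex_probs_eqI\<close> recognizes it.\<close>

lemma simplex_probs_eq_nonempty:
  "(simplex_probs_eq :: (real ^ 'n) measure set) \<noteq> {}"
proof -
  define f :: "'n \<Rightarrow> real ^ 'n" where "f = (\<lambda>i. axis i 1)"
  have n: "norm (f i) = 1" for i by (simp add: f_def)
  have ip: "f i \<bullet> f j = of_bool (i = j)" for i j
    by (auto simp: f_def inner_axis_axis)
  have o: "pairwise orthogonal (range f)"
    by (auto simp: pairwise_def orthogonal_def ip)
  have "AE x in unif_points f. x \<in> (\<Union>v\<in>range f. {v, -v})"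
    using n by (subst unif_points_AE_iff) auto
  moreover have "(\<Sum>l\<in>UNIV. Lam_pow 1 (f l) (f k)) = real CARD('n) - 1" for k
  proof -
    have "(\<Sum>l\<in>UNIV. Lam_pow 1 (f l) (f k)) = (\<Sum>l\<in>UNIV. 1 - (if l = k then 1 else 0))"
      by (intro sum.cong refl, subst Lam_pow_eq_of_bool) (auto simp: n ip)
    then show ?thesis by (simp add: sum_subtractf)
  qed
  then have "energy 1 (unif_points f) = 1 / 2 * (1 - 1 / CARD('n))"
    by (subst energy_unif_points[of f 1, OF n]) (simp_all add: diff_divide_distrib)
  ultimately have "unif_points f \<in> simplex_probs_eq"
    using simplex_probs_eqI[OF unif_points_in_sphere_probs[of f, OF n] o, of 1] n by auto
  then show ?thesis by blast
qed

text \<open>Turning two axes of an orthonormal frame by 45 degrees within their plane gives a second frame. For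
  a point on either frame the values of \<open>\<Lambda>\<close> against both frames have the same sum, so the
  uniform measure on the union of the frames has the energy of a simplex measure at \<open>\<alpha> = 1\<close>.\<close>

lemma Lam_half:
  fixes x y :: "real ^ 'n"
  assumes "\<bar>x \<bullet> y\<bar> = 1 / sqrt 2"
  shows "Lam x y = 1 / 2"
proof -
  have xy: "x \<bullet> y = 1 / sqrt 2 \<or> x \<bullet> y = - (1 / sqrt 2)" using assms by linarith
  have neg: "arccos (- (1 / sqrt 2)) = pi - pi / 4"
    by (subst arccos_minus) (auto simp: arccos_one_over_sqrt_2 intro: order_trans[of _ 0])
  have "arccos (x \<bullet> y) = pi / 4 \<or> arccos (x \<bullet> y) = pi - pi / 4"
    using xy neg arccos_one_over_sqrt_2 by metis
  then show ?thesis
    using pi_gt_zero by (auto simp: Lam_def geodist_def min_def field_simps simp del: pi_gt_zero)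
qed

lemma ex_non_simplex_energy_1:
  assumes "CARD('n) \<ge> 2"
  shows "\<exists>\<mu> :: (real ^ 'n) measure. \<mu> \<in> sphere_probs \<and> \<mu> \<notin> simplex_probs_eq \<and>
    energy 1 \<mu> = 1 / 2 * (1 - 1 / CARD('n))"
proof -
  obtain p q :: 'n where pq: "p \<noteq> q"
    using assms card_le_Suc0_iff_eq[of "UNIV :: 'n set"] by force
  define e :: "'n \<Rightarrow> real ^ 'n" where "e = (\<lambda>i. axis i 1)"
  define s where "s = 1 / sqrt 2"
  have ss: "s * s = 1 / 2" "s > 0" by (auto simp: s_def)
  \<comment> \<open>The Boolean selects the frame: \<open>True\<close> the coordinate one,
    \<open>False\<close> the turned one. \<open>s *\<^sub>R (e p - e q)\<close> is the turned
    \<open>e q\<close> up to a sign, to which \<open>Lam\<close> is blind.\<close>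
  define f :: "'n \<times> bool \<Rightarrow> real ^ 'n" where "f = (\<lambda>(i, b).
    if b then e i
    else if i = p then s *\<^sub>R (e p + e q)
    else if i = q then s *\<^sub>R (e p - e q)
    else e i)"
  have e: "e i \<bullet> e j = of_bool (i = j)" for i j
    by (auto simp: e_def inner_axis_axis)
  have ip_same: "f (i, b) \<bullet> f (j, b) = of_bool (i = j)" for i j b
    using pq ss by (auto simp: f_def e inner_add_left inner_add_right inner_diff_left inner_diff_right)
  have ip_diff: "f (i, \<not> b) \<bullet> f (j, b) =
    (if j \<in> {p, q} \<and> i \<in> {p, q} then (if i = q \<and> j = q then - s else s) else of_bool (i = j))" for i j b
    using pq by (cases b) (auto simp: f_def e inner_add_left inner_add_right inner_diff_left inner_diff_right)
  have n: "norm (f k) = 1" for k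
    by (cases k) (simp add: norm_eq_1 ip_same)
  have L: "Lam_pow 1 x y = Lam x y" if "norm x = 1" "norm y = 1" for x y :: "real ^ 'n"
    using Lam_bounds[OF that] by (simp add: Lam_pow_def)
  have same: "Lam_pow 1 (f (i, b)) (f (j, b)) = 1 - of_bool (i = j)" for i j b
    using ip_same[of i b j] n by (subst Lam_pow_eq_of_bool) auto
  \<comment> \<open>The kernel is written as 1 minus a deficit whose sum over \<open>i\<close> is 1
    for every \<open>j\<close>: two halves inside the turned plane, a single 1 outside it.\<close>
  have diff: "Lam_pow 1 (f (i, \<not> b)) (f (j, b)) =
    1 - (if j \<in> {p, q} then (of_bool (i = p) + of_bool (i = q)) / 2 else of_bool (i = j))" for i j b
  proof (cases "j \<in> {p, q} \<and> i \<in> {p, q}")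
    case True
    then have "\<bar>f (i, \<not> b) \<bullet> f (j, b)\<bar> = s" using ip_diff[of i b j] ss by auto
    then have "Lam_pow 1 (f (i, \<not> b)) (f (j, b)) = 1 / 2"
      using L[OF n n] Lam_half by (simp add: s_def)
    then show ?thesis using True pq by auto
  next
    case False
    then have "f (i, \<not> b) \<bullet> f (j, b) = of_bool (i = j)" using ip_diff[of i b j] by auto
    then show ?thesis
      using n False by (subst Lam_pow_eq_of_bool) auto
  qed
  \<comment> \<open>Each of the two frames contributes the dimension minus its total deficit
    1.\<close>
  have row: "(\<Sum>l\<in>UNIV. Lam_pow 1 (f l) (f k)) = 2 * (real CARD('n) - 1)" for k
  proof -
    obtain j b where k: "k = (j, b)" by (cases k)
    have "(\<Sum>l\<in>UNIV. Lam_pow 1 (f l) (f k)) =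
        (\<Sum>i\<in>UNIV. \<Sum>c\<in>UNIV. Lam_pow 1 (f (i, c)) (f k))"
      by (simp add: sum.cartesian_product split_beta)
    also have "\<dots> = (\<Sum>i\<in>UNIV. Lam_pow 1 (f (i, b)) (f k) + Lam_pow 1 (f (i, \<not> b)) (f k))"
      by (cases b) (auto simp: UNIV_bool add.commute)
    also have "\<dots> = (\<Sum>i\<in>UNIV. 1 - of_bool (i = j)) +
        (\<Sum>i\<in>UNIV. 1 - (if j \<in> {p, q} then (of_bool (i = p) + of_bool (i = q)) / 2 else of_bool (i = j)))"
      unfolding k sum.distrib same diff ..
    also have "\<dots> = 2 * (real CARD('n) - 1)"
      by (cases "j \<in> {p, q}")
        (simp_all add: sum_subtractf sum.distrib of_bool_def flip: sum_divide_distrib)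
    finally show ?thesis .
  qed
  have "CARD('n \<times> bool) = 2 * CARD('n)" by simp
  then have energy: "energy 1 (unif_points f) = 1 / 2 * (1 - 1 / CARD('n))"
    by (subst energy_unif_points[of f 1, OF n]) (simp_all add: row diff_divide_distrib)
  have "unif_points f \<notin> simplex_probs_eq"
  \<comment> \<open>The frame of a simplex measure would have both \<open>f (p, True)\<close> and
    \<open>f (p, False)\<close> on its axes, but their inner product \<open>s\<close> is none of 0,
    1, -1.\<close>
  proof
    assume "unif_points f \<in> simplex_probs_eq"
    from simplex_probs_eqD[OF this]
    obtain B where B: "orthonormal_basis B" "AE x in unif_points f. x \<in> (\<Union>v\<in>B. {v, -v})"
      by blast
    note o = orthonormal_basisD[OF B(1)]
    have "range f \<subseteq> (\<Union>v\<in>B. {v, -v})"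
      using B(2) o n by (subst (asm) unif_points_AE_iff) auto
    then have "f k \<in> (\<Union>v\<in>B. {v, -v})" for k by blast
    from this[of "(p, True)"] this[of "(p, False)"]
    obtain v w where vw: "v \<in> B" "w \<in> B" "f (p, True) \<in> {v, -v}" "f (p, False) \<in> {w, -w}"
      by blast
    have "v \<bullet> w \<in> {0, 1}"
      using o vw by (cases "v = w") (auto simp: pairwise_def orthogonal_def dot_square_norm)
    then have "f (p, False) \<bullet> f (p, True) \<in> {0, 1, -1}"
      using vw by (auto simp: inner_commute)
    moreover have "f (p, False) \<bullet> f (p, True) = s"
      using ip_diff[of p True p] pq by simp
    ultimately show False using ss by auto
  qed
  then show ?thesis
    using energy unif_points_in_sphere_probs[of f, OF n] by blast
qed

section \<open>Existence and uniqueness of the threshold exponent\<close>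

theorem lemma1p1:
  fixes d :: nat
  assumes "d \<ge> 1" and "CARD('n::finite) = d + 1"
  shows "(\<exists>!a::ereal. 1 \<le> a \<and>
            (\<forall>\<alpha>. 0 < \<alpha> \<and> \<alpha> < a \<longrightarrow>
               (simplex_probs_eq :: (real ^ 'n) measure set) \<inter> energy_argmax \<alpha> = {}) \<and>
            (\<forall>\<alpha>. a < \<alpha> \<longrightarrow>
               (simplex_probs_eq :: (real ^ 'n) measure set) = energy_argmax \<alpha>)) \<and>
         (simplex_probs_eq :: (real ^ 'n) measure set) \<noteq> energy_argmax 1 \<and>
         ((simplex_probs_eq :: (real ^ 'n) measure set) \<subset> energy_argmax 1 \<or>
          (simplex_probs_eq :: (real ^ 'n) measure set) \<inter> energy_argmax 1 = {})"
proof -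
  let ?P = "simplex_probs_eq :: (real ^ 'n) measure set"
  obtain \<nu> :: "(real ^ 'n) measure" where nu: "\<nu> \<in> ?P"
    using simplex_probs_eq_nonempty by blast
  obtain \<mu> :: "(real ^ 'n) measure" where mu: "\<mu> \<in> sphere_probs" "\<mu> \<notin> ?P"
    "energy 1 \<mu> = 1 / 2 * (1 - 1 / CARD('n))"
    using ex_non_simplex_energy_1[where 'n = 'n] assms by auto
  \<comment> \<open>At exponent 1, \<mu> ties with the simplex measures, so it maximizes as soon as
    they do.\<close>
  have ne: "?P \<noteq> energy_argmax 1"
  proof
    assume "?P = energy_argmax 1"
    with nu have "\<nu> \<in> energy_argmax 1" by simp
    then have "\<mu> \<in> energy_argmax 1"
      using mu energy_simplex_probs_eq[OF nu, of 1] unfolding energy_argmax_iff by auto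
    then show False using mu \<open>?P = energy_argmax 1\<close> by simp
  qed
  have dich: "?P \<subset> energy_argmax 1 \<or> ?P \<inter> energy_argmax 1 = {}"
    using ne simplex_probs_eq_all_or_none[of 1, where 'n = 'n] by auto
  \<comment> \<open>For empty \<open>T\<close> the infimum in \<open>ereal\<close> would be
    \<infinity>, still an admissible threshold.\<close>
  define T where "T = {\<alpha>::ereal. 0 < \<alpha> \<and> ?P \<inter> energy_argmax \<alpha> \<noteq> {}}"
  \<comment> \<open>A member of \<open>T\<close> below 1 would force equality at exponent 1, against
    \<open>ne\<close>.\<close>
  have T1: "1 \<le> \<alpha>" if "\<alpha> \<in> T" for \<alpha>
    using that ne simplex_probs_eq_argmax_above[of \<alpha> 1, where 'n = 'n]
    by (force simp: T_def not_le[symmetric])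
  have "\<exists>!a::ereal. 1 \<le> a \<and> (\<forall>\<alpha>. 0 < \<alpha> \<and> \<alpha> < a \<longrightarrow> ?P \<inter> energy_argmax \<alpha> = {}) \<and>
            (\<forall>\<alpha>. a < \<alpha> \<longrightarrow> ?P = energy_argmax \<alpha>)"
  proof (rule ex1I[of _ "Inf T"], intro conjI allI impI)
    show "1 \<le> Inf T" using T1 by (intro Inf_greatest)
    show "?P \<inter> energy_argmax \<alpha> = {}" if "0 < \<alpha> \<and> \<alpha> < Inf T" for \<alpha>
      using that Inf_lower[of \<alpha> T] by (force simp: T_def not_le[symmetric])
    show "?P = energy_argmax \<alpha>" if "Inf T < \<alpha>" for \<alpha>
    proof -
      from that obtain \<beta> where "\<beta> \<in> T" "\<beta> < \<alpha>" unfolding Inf_less_iff by blast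
      then show ?thesis using simplex_probs_eq_argmax_above[of \<beta> \<alpha>, where 'n = 'n] by (auto simp: T_def)
    qed
    fix a :: ereal
    assume a: "1 \<le> a \<and> (\<forall>\<alpha>. 0 < \<alpha> \<and> \<alpha> < a \<longrightarrow> ?P \<inter> energy_argmax \<alpha> = {}) \<and>
            (\<forall>\<alpha>. a < \<alpha> \<longrightarrow> ?P = energy_argmax \<alpha>)"
    have "a \<le> Inf T"
      using a by (intro Inf_greatest) (auto simp: T_def not_less[symmetric])
    moreover have "Inf T \<le> a"
    proof (rule ccontr)
      assume "\<not> Inf T \<le> a"
      then have "a < Inf T" by simp
      then obtain \<beta> where b: "a < \<beta>" "\<beta> < Inf T" using dense by blast
      have "(0::ereal) < 1" by simp
      also have "1 \<le> a" using a by simp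
      also note \<open>a < \<beta>\<close>
      finally have "0 < \<beta>" .
      \<comment> \<open>Equality of the two sets above \<open>a\<close> puts \<nu> into the
        intersection; non-emptiness of the simplex class enters here.\<close>
      then have "\<beta> \<in> T" using a b nu by (auto simp: T_def)
      then show False using b Inf_lower[of \<beta> T] by auto
    qed
    ultimately show "a = Inf T" by simp
  qed
  with ne dich show ?thesis by blast
qed

end
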